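(* Let $A\subseteq\{1^2,2^2,\ldots,N^2\}$ be a Sidon set. Then $$|A|\le N\exp\left(-\left(\frac{\log 2}{2}-o(1)\right)\frac{\log N}{\log\log N}\right),$$ where $o(1)$ denotes a quantity depending only on $N$ that tends to $0$ as $N\to\infty$.
   Context: A set $A$ of integers is a Sidon set if all sums $a+a'$ with $a,a'\in A$ are distinct up to the trivial symmetry $a+a'=a'+a$. *)

theory Defs
  imports Complex_Main
begin

definition sidon_set :: "int set \<Rightarrow> bool" where
  "sidon_set A \<longleftrightarrow>
     (\<forall>a\<in>A. \<forall>b\<in>A. \<forall>c\<in>A. \<forall>d\<in>A.
        a + b = c + d \<longrightarrow> (a = c \<and> b = d) \<or> (a = d \<and> b = c))"

end

theory Submission
  imports Defs "HOL-Computational_Algebra.Primes" "HOL-Library.FuncSet"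
    "HOL-Analysis.Harmonic_Numbers" "HOL-Real_Asymp.Real_Asymp"
begin

text \<open>
  Each odd prime dividing a squarefree modulus \<open>P\<close> roughly halves the number of residue classes that squares can
  occupy: if \<open>P\<close> is a product of \<open>k\<close> odd primes, the squares meet only about \<open>P / 2 ^ k\<close> classes
  modulo \<open>P\<close>. So a set \<open>A\<close> of squares has, by Cauchy--Schwarz, at least about \<open>card A ^ 2 * 2 ^ k / P\<close>
  pairs \<open>(a, b)\<close> with \<open>a - b\<close> divisible by \<open>P\<close>. If \<open>A\<close> is a Sidon set, each nonzero multiple of \<open>P\<close>
  between \<open>-N\<^sup>2\<close> and \<open>N\<^sup>2\<close> is a difference at most once, so there are at most
  \<open>card A + 2 * N\<^sup>2 / P\<close> such pairs. Comparing the two counts for \<open>P \<le> N\<close> gives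
  \<open>card A\<^sup>2 \<le> 3 * N\<^sup>2 * (n + 1) / 2 ^ k\<close> when the primes are at most \<open>n\<close> (lemma
  \<open>sidon_squares_card_bound\<close>); the factor \<open>n + 1\<close> bounds the product of \<open>1 + 1 / p\<close>, which enters
  because 0 is a square modulo \<open>p\<close> as well.

  It remains to take \<open>k\<close> as large as possible subject to \<open>P \<le> N\<close>. With \<open>L = ln N\<close>, primes up to
  \<open>n \<approx> 3 * L\<close> and \<open>k = \<lfloor>L / ln n\<rfloor>\<close> one has \<open>P \<le> n ^ k \<le> N\<close> and \<open>k \<sim> L / ln L\<close>, and the
  loss \<open>n + 1\<close> is only \<open>exp (o(k))\<close>; the square root of \<open>2 ^ k\<close> is the source of the constant
  \<open>ln 2 / 2\<close>. That enough primes below \<open>3 * L\<close> exist is Chebyshev's lower bound for the number of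
  primes (lemma \<open>card_odd_primes_ge\<close>), which is derived from
  \<open>2 ^ n = (\<Sum>m\<le>n. n choose m)\<close> and the fact that every \<open>m * (n choose m)\<close> with \<open>m \<ge> 1\<close> divides
  every common multiple of \<open>1, \<dots>, n\<close>.
\<close>

section \<open>A Chebyshev-type lower bound for the number of primes\<close>

text \<open>
  The reciprocals \<open>1 / (m * (j choose m))\<close> are the entries of Leibniz's harmonic triangle: the one in
  row \<open>j\<close>, position \<open>m + 1\<close> is the difference of those in rows \<open>j - 1\<close> and \<open>j\<close> at position \<open>m\<close>, and the
  first entry of row \<open>j\<close> is \<open>1 / j\<close>. Hence a number \<open>D\<close> that clears the denominators \<open>1, \<dots>, n\<close> clears all
  the denominators of the first \<open>n\<close> rows.
\<close>

lemma mult_binomial_dvd_common_multiple: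
  fixes D n :: nat
  assumes D: "\<And>i. \<lbrakk>1 \<le> i; i \<le> n\<rbrakk> \<Longrightarrow> i dvd D"
  shows "\<lbrakk>1 \<le> m; m \<le> j; j \<le> n\<rbrakk> \<Longrightarrow> m * (j choose m) dvd D"
proof (induction m arbitrary: j)
  case 0
  then show ?case by simp
next
  case (Suc m)
  show ?case
  proof (cases "m = 0")
    case True
    with Suc.prems D show ?thesis by simp
  next
    case False
    from Suc.prems obtain i where j: "j = Suc i" by (cases j) auto
    with Suc.prems have mi: "m \<le> i" by simp
    define B where "B = real (i choose m)"
    have "m * (i choose m) dvd D" "m * (j choose m) dvd D"
      using Suc.IH[of i] Suc.IH[of j] False Suc.prems j by simp_all
    then obtain x y where x: "D = m * (i choose m) * x" and y: "D = m * (j choose m) * y"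
      by (metis dvdE)
    have "(j - m) * (j choose m) = j * (i choose m)"
      using binomial_absorb_comp[of j m] j by simp
    then have "real (j - m) * real (j choose m) = real j * B"
      unfolding B_def by (metis of_nat_mult)
    then have c1: "(real j - real m) * real (j choose m) = real j * B"
      using mi j by (simp only: of_nat_diff le_SucI)
    have "real (Suc m * (j choose Suc m)) = real (j * (i choose m))"
      using Suc_times_binomial[of m i] j by (metis mult.commute)
    then have c2: "real (Suc m * (j choose Suc m)) = real j * B" by (simp add: B_def)
    have x': "real D = real m * B * real x" using x by (simp add: B_def)
    have y': "real D = real m * real (j choose m) * real y" using y by (metis of_nat_mult)
    \<comment> \<open>The triangle's recurrence, with \<open>x\<close> and \<open>y\<close> as \<open>D\<close> times the entries at position \<open>m\<close>.\<close>
    have "real m * (real j * B * (real x - real y)) = real j * real D - real m * real y * (real j * B)"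
      by (simp add: x' algebra_simps)
    also have "\<dots> = real j * real D - (real j - real m) * (real m * real (j choose m) * real y)"
      unfolding c1[symmetric] by (simp add: algebra_simps)
    also have "\<dots> = real m * real D" unfolding y'[symmetric] by (simp add: algebra_simps)
    finally have "real j * B * (real x - real y) = real D" using False by simp
    then have "real_of_int (int (Suc m * (j choose Suc m)) * (int x - int y)) = real_of_int (int D)"
      by (simp only: c2 of_int_mult of_int_diff of_int_of_nat_eq)
    then have "int (Suc m * (j choose Suc m)) * (int x - int y) = int D"
      by (simp only: of_int_eq_iff)
    then show ?thesis by (metis dvd_triv_left int_dvd_int_iff)
  qed
qed

text \<open>
  The witness is the least common multiple of \<open>1, \<dots>, n\<close>, written as the product over the primes
  \<open>p \<le> n\<close> of the largest power of \<open>p\<close> not exceeding \<open>n\<close>; each such factor is at most \<open>n\<close>.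
\<close>

lemma ex_common_multiple_le_power_primes:
  fixes n :: nat
  assumes "n \<ge> 1"
  obtains D :: nat where "D > 0" "D \<le> n ^ card {p. prime p \<and> p \<le> n}"
    "\<And>i. \<lbrakk>1 \<le> i; i \<le> n\<rbrakk> \<Longrightarrow> i dvd D"
proof -
  define Q where "Q = {p::nat. prime p \<and> p \<le> n}"
  define e where "e = (\<lambda>p::nat. GREATEST k. p ^ k \<le> n)"
  define D where "D = (\<Prod>p\<in>Q. p ^ e p)"
  have fin: "finite Q" by (simp add: Q_def)
  have bd: "k \<le> n" if "p ^ k \<le> n" "prime p" for p k :: nat
    using power_gt_expt[of p k] prime_gt_1_nat[of p] that by linarith
  have e_le: "p ^ e p \<le> n" if p: "prime p" for p
    unfolding e_def
  proof (rule GreatestI_nat[where P = "\<lambda>k. p ^ k \<le> n"])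
    show "p ^ 0 \<le> n" using assms by simp
  qed (rule bd[OF _ p])
  have le_e: "k \<le> e p" if p: "prime p" and le: "p ^ k \<le> n" for p k
    unfolding e_def using le bd[OF _ p] by (rule Greatest_le_nat[where P = "\<lambda>k. p ^ k \<le> n"])
  show ?thesis
  proof (rule that)
    show "D > 0" by (auto simp: D_def Q_def intro!: prod_pos prime_gt_0_nat)
    show "D \<le> n ^ card {p. prime p \<and> p \<le> n}"
      unfolding D_def Q_def[symmetric]
      using prod_mono[of Q "\<lambda>p. p ^ e p" "\<lambda>_. n"] e_le by (simp add: Q_def)
  next
    fix i :: nat assume i: "1 \<le> i" "i \<le> n"
    have sub: "prime_factors i \<subseteq> Q"
      using i by (auto simp: Q_def prime_factors_dvd dest: dvd_imp_le)
    have "i = (\<Prod>p\<in>prime_factors i. p ^ multiplicity p i)"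
      using i prod_prime_factors[of i] by simp
    also have "\<dots> dvd (\<Prod>p\<in>prime_factors i. p ^ e p)"
    proof (rule prod_dvd_prod)
      fix p assume "p \<in> prime_factors i"
      then have p: "prime p" by auto
      have "p ^ multiplicity p i \<le> i" using i by (intro dvd_imp_le multiplicity_dvd) simp
      then show "p ^ multiplicity p i dvd p ^ e p"
        using i le_e[OF p] by (intro le_imp_power_dvd) simp
    qed
    also have "\<dots> dvd D" unfolding D_def by (rule prod_dvd_prod_subset[OF fin sub])
    finally show "i dvd D" .
  qed
qed

lemma two_power_le_power_primes:
  fixes n :: nat
  assumes "n \<ge> 1"
  shows "2 ^ n \<le> (n + 1) * n ^ card {p. prime p \<and> p \<le> n}"
proof -
  obtain D :: nat where D: "D > 0" "D \<le> n ^ card {p. prime p \<and> p \<le> n}"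
    "\<And>i. \<lbrakk>1 \<le> i; i \<le> n\<rbrakk> \<Longrightarrow> i dvd D"
    using ex_common_multiple_le_power_primes[OF assms] by blast
  have "(n choose m) \<le> D" if "m \<le> n" for m
  proof (cases "m = 0")
    case False
    have "(n choose m) dvd D"
      using mult_binomial_dvd_common_multiple[of n D m n] D(3) that False
      by (metis One_nat_def Suc_leI dvd_mult_right le_refl not_gr_zero)
    then show ?thesis using D(1) dvd_imp_le by blast
  qed (use D(1) in simp)
  then have "(\<Sum>m\<le>n. n choose m) \<le> (\<Sum>m\<le>n. D)" by (intro sum_mono) simp
  then have "2 ^ n \<le> (n + 1) * D" by (simp add: choose_row_sum)
  also have "\<dots> \<le> (n + 1) * n ^ card {p. prime p \<and> p \<le> n}" using D(2) by (rule mult_le_mono2)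
  finally show ?thesis .
qed

text \<open>
  Logarithmic form of the previous bound; the final \<open>- 1\<close> is the cost of discarding the prime 2.
\<close>

lemma card_odd_primes_ge:
  fixes n :: nat
  assumes "n \<ge> 2"
  shows "(real n * ln 2 - ln (real n + 1)) / ln (real n) - 1
           \<le> real (card {p. prime p \<and> odd p \<and> p \<le> n})"
proof -
  define r where "r = card {p. prime p \<and> odd p \<and> p \<le> n}"
  have "{p. prime p \<and> p \<le> n} \<subseteq> insert 2 {p. prime p \<and> odd p \<and> p \<le> n}"
    using prime_odd_nat prime_ge_2_nat by (auto simp: le_less)
  then have "card {p. prime p \<and> p \<le> n} \<le> card (insert 2 {p. prime p \<and> odd p \<and> p \<le> n})"
    by (intro card_mono) auto
  also have "\<dots> \<le> r + 1" by (simp add: card_insert_if r_def)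
  finally have c: "card {p. prime p \<and> p \<le> n} \<le> r + 1" .
  have "2 ^ n \<le> (n + 1) * n ^ card {p. prime p \<and> p \<le> n}"
    using assms by (intro two_power_le_power_primes) simp
  also have "\<dots> \<le> (n + 1) * n ^ (r + 1)"
    using assms c by (intro mult_left_mono power_increasing) auto
  finally have "real (2 ^ n) \<le> real ((n + 1) * n ^ (r + 1))" by (simp only: of_nat_le_iff)
  then have "2 ^ n \<le> (real n + 1) * real n ^ (r + 1)"
    by (simp only: of_nat_mult of_nat_add of_nat_power of_nat_numeral of_nat_1)
  then have "ln (2 ^ n :: real) \<le> ln ((real n + 1) * real n ^ (r + 1))"
    using assms by (subst ln_le_cancel_iff) (auto simp del: power_Suc)
  also have "\<dots> = ln (real n + 1) + (real r + 1) * ln (real n)"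
    using assms by (subst ln_mult) (auto simp: ln_realpow simp del: power_Suc)
  finally have "real n * ln 2 - ln (real n + 1) \<le> (real r + 1) * ln (real n)"
    by (simp add: ln_realpow)
  then have "(real n * ln 2 - ln (real n + 1)) / ln (real n) \<le> real r + 1"
    using assms by (simp add: pos_divide_le_eq)
  then show ?thesis unfolding r_def by simp
qed

section \<open>Squares modulo a product of odd primes\<close>

text \<open>
  Since \<open>x\<close> and \<open>p - x\<close> have the same square modulo \<open>p = 2 * h + 1\<close>, the residues \<open>0, \<dots>, h\<close> already
  produce all squares.
\<close>

lemma card_squares_mod_le:
  fixes p :: nat
  assumes "odd p"
  shows "finite ((\<lambda>x::nat. (int x)\<^sup>2 mod int p) ` UNIV)"
    and "2 * card ((\<lambda>x::nat. (int x)\<^sup>2 mod int p) ` UNIV) \<le> p + 1"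
proof -
  let ?f = "\<lambda>x::nat. (int x)\<^sup>2 mod int p"
  from assms obtain h where h: "p = 2 * h + 1" by (elim oddE)
  have "?f x \<in> ?f ` {..h}" for x
  proof -
    define r where "r = x mod p"
    have r: "r < p" using h by (simp add: r_def)
    have fr: "?f x = ?f r" unfolding r_def by (simp add: zmod_int power_mod)
    show ?thesis
    proof (cases "r \<le> h")
      case True
      then show ?thesis using fr by blast
    next
      case False
      have "(int (p - r))\<^sup>2 = (int r)\<^sup>2 + int p * (int p - 2 * int r)"
        using r by (simp add: of_nat_diff power2_eq_square algebra_simps)
      then have "?f (p - r) = ?f r" by simp
      moreover have "p - r \<in> {..h}" using False h by simp
      ultimately show ?thesis using fr by (intro image_eqI[of _ _ "p - r"]) simp_all
    qed
  qed
  then have sub: "range ?f \<subseteq> ?f ` {..h}" by blast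
  then show "finite (range ?f)" by (rule finite_subset) simp
  have "card (range ?f) \<le> card (?f ` {..h})" using sub by (intro card_mono) auto
  also have "\<dots> \<le> card {..h}" by (rule card_image_le) simp
  finally show "2 * card (range ?f) \<le> p + 1" using h by simp
qed

lemma dvd_diff_prod_if_mod_eq:
  fixes Q :: "nat set"
  assumes "finite Q" "\<And>p. p \<in> Q \<Longrightarrow> prime p"
    and "\<And>p. p \<in> Q \<Longrightarrow> a mod int p = b mod int p"
  shows "int (\<Prod>Q) dvd a - b"
  using assms
proof (induction Q rule: finite_induct)
  case (insert p Q)
  have "coprime p (\<Prod>Q)"
    using insert by (intro prod_coprime_right) (metis insertCI primes_coprime)
  then have "coprime (int p) (int (\<Prod>Q))" by (simp only: coprime_int_iff)
  moreover have "int p dvd a - b" using insert.prems(2)[of p] by (simp add: mod_eq_dvd_iff)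
  moreover have "int (\<Prod>Q) dvd a - b" using insert by simp
  ultimately have "int p * int (\<Prod>Q) dvd a - b" by (rule divides_mult[rotated 2])
  then show ?case using insert by simp
qed simp

text \<open>
  The product of \<open>1 + 1 / p\<close> over \<open>Q\<close> only grows when \<open>Q\<close> is enlarged to \<open>{1..n}\<close>, where it telescopes.
  This crude bound suffices because \<open>n\<close> will be of logarithmic size.
\<close>

lemma prod_Suc_le:
  fixes Q :: "nat set"
  assumes "Q \<subseteq> {1..n}"
  shows "(\<Prod>p\<in>Q. real p + 1) \<le> (real n + 1) * (\<Prod>p\<in>Q. real p)"
proof -
  have tel: "(\<Prod>p\<in>{1..n}. 1 + 1 / real p) = real n + 1"
    by (induction n) (simp_all add: field_simps)
  have "(\<Prod>p\<in>Q. real p + 1) = (\<Prod>p\<in>Q. (1 + 1 / real p) * real p)"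
    using assms by (intro prod.cong) (auto simp: field_simps)
  also have "\<dots> = (\<Prod>p\<in>Q. 1 + 1 / real p) * (\<Prod>p\<in>Q. real p)" by (rule prod.distrib)
  also have "(\<Prod>p\<in>Q. 1 + 1 / real p) \<le> (\<Prod>p\<in>{1..n}. 1 + 1 / real p)"
    using assms by (intro prod_mono2) auto
  finally show ?thesis using tel by (simp add: mult_right_mono prod_nonneg)
qed

section \<open>Counting congruent pairs in a Sidon set of squares\<close>

text \<open>
  Cauchy--Schwarz for the sizes of the fibres of \<open>f\<close>: few values force many coincidences.
\<close>

lemma card_squared_le_card_image_times_card_pairs:
  assumes "finite A"
  shows "(card A)\<^sup>2 \<le> card (f ` A) * card {(a, b). a \<in> A \<and> b \<in> A \<and> f a = f b}"
proof -
  define F where "F = (\<lambda>y. {a \<in> A. f a = y})"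
  have finF: "finite (F y)" for y using assms by (simp add: F_def)
  have A: "A = (\<Union>y\<in>f ` A. F y)" by (auto simp: F_def)
  have cA: "card A = (\<Sum>y\<in>f ` A. card (F y))"
    by (subst A, rule card_UN_disjoint) (use assms finF in \<open>auto simp: F_def\<close>)
  have P: "{(a, b). a \<in> A \<and> b \<in> A \<and> f a = f b} = (\<Union>y\<in>f ` A. F y \<times> F y)"
    by (auto simp: F_def)
  have cP: "card {(a, b). a \<in> A \<and> b \<in> A \<and> f a = f b} = (\<Sum>y\<in>f ` A. (card (F y))\<^sup>2)"
    unfolding P
    by (subst card_UN_disjoint)
       (use assms finF in \<open>auto simp: F_def power2_eq_square card_cartesian_product\<close>)
  have "real ((card A)\<^sup>2) = (\<Sum>y\<in>f ` A. real (card (F y)))\<^sup>2" by (simp add: cA)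
  also have "\<dots> \<le> (\<Sum>y\<in>f ` A. (real (card (F y)))\<^sup>2) * real (card (f ` A))"
    by (rule sum_squared_le_sum_of_squares)
  also have "\<dots> = real (card (f ` A) * card {(a, b). a \<in> A \<and> b \<in> A \<and> f a = f b})"
    by (simp add: cP)
  finally show ?thesis by (simp only: of_nat_le_iff)
qed

text \<open>
  In a Sidon set a nonzero difference determines the pair it comes from, so off the diagonal there are at
  most as many pairs as nonzero multiples of \<open>P\<close> in \<open>{-M..M}\<close>.
\<close>

lemma sidon_card_congruent_pairs_le:
  fixes A :: "int set" and M :: int and P :: nat
  assumes sidon: "sidon_set A" and A: "A \<subseteq> {0..M}" and M: "M \<ge> 0" and P: "P > 0"
  shows "real (card {(a, b). a \<in> A \<and> b \<in> A \<and> int P dvd a - b})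
           \<le> real (card A) + 2 * real_of_int M / real P"
proof -
  have finA: "finite A" using A finite_subset by blast
  define E where "E = {(a, b). a \<in> A \<and> b \<in> A \<and> int P dvd a - b}"
  define E1 where "E1 = {(a, b) \<in> E. a \<noteq> b}"
  define K where "K = M div int P"
  have finE: "finite E"
    by (rule finite_subset[of _ "A \<times> A"]) (use finA in \<open>auto simp: E_def\<close>)
  have "E \<subseteq> (\<lambda>a. (a, a)) ` A \<union> E1" by (auto simp: E_def E1_def)
  moreover have finE1: "finite E1" using finE by (rule finite_subset[rotated]) (auto simp: E1_def)
  ultimately have "card E \<le> card ((\<lambda>a. (a, a)) ` A \<union> E1)"
    using finA by (intro card_mono) auto
  also have "\<dots> \<le> card ((\<lambda>a. (a, a)) ` A) + card E1" by (rule card_Un_le)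
  also have "\<dots> \<le> card A + card E1" using card_image_le[OF finA] by simp
  finally have cE: "card E \<le> card A + card E1" .
  let ?d = "\<lambda>(a, b). (a - b) div int P"
  have "inj_on ?d E1"
  proof (rule inj_onI, clarify)
    fix a b c d assume ab: "(a, b) \<in> E1" and cd: "(c, d) \<in> E1"
      and eq: "(a - b) div int P = (c - d) div int P"
    have "a - b = c - d" using ab cd eq P by (auto simp: E1_def E_def elim!: dvdE)
    then have "a + d = c + b" by simp
    then have "(a = c \<and> d = b) \<or> (a = b \<and> d = c)"
      using sidon ab cd unfolding sidon_set_def E1_def E_def by blast
    then show "a = c \<and> b = d" using ab by (auto simp: E1_def)
  qed
  moreover have "?d ` E1 \<subseteq> {-K..K} - {0}"
  proof clarify
    fix a b assume ab: "(a, b) \<in> E1"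
    then obtain k where k: "a - b = int P * k" by (auto simp: E1_def E_def elim!: dvdE)
    have d: "(a - b) div int P = k" using k P by simp
    have "k \<noteq> 0" using ab k by (auto simp: E1_def)
    have "0 \<le> a" "a \<le> M" "0 \<le> b" "b \<le> M" using ab A by (auto simp: E1_def E_def)
    then have "k * int P \<le> M" "(- k) * int P \<le> M" using k by (simp_all add: mult.commute)
    then have "k \<le> K" "- k \<le> K" unfolding K_def using P
      by (metis nonzero_mult_div_cancel_right of_nat_0_less_iff zdiv_mono1 less_irrefl)+
    with d \<open>k \<noteq> 0\<close> show "(a - b) div int P \<in> {-K..K} - {0}" by simp
  qed
  ultimately have "card E1 \<le> card ({-K..K} - {0})" by (intro card_inj_on_le) auto
  also have "\<dots> = nat (2 * K)"
    using M P by (subst card_Diff_singleton) (auto simp: K_def pos_imp_zdiv_nonneg_iff)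
  finally have "card E1 \<le> nat (2 * K)" .
  moreover have "K \<ge> 0" using M P by (simp add: K_def pos_imp_zdiv_nonneg_iff)
  ultimately have "real (card E1) \<le> 2 * real_of_int K" by linarith
  moreover have "real_of_int K \<le> real_of_int M / real P"
    unfolding K_def using floor_divide_of_int_eq[of M "int P", where ?'a=real]
    by (metis of_int_floor_le of_int_of_nat_eq)
  ultimately show ?thesis using cE unfolding E_def by linarith
qed

text \<open>
  Both counts of the congruent pairs are made modulo \<open>P = \<Prod>Q\<close>. The residue class modulo \<open>P\<close> is encoded
  as the family \<open>f\<close> of residues modulo the members of \<open>Q\<close>, so that the number of classes met by \<open>A\<close> is
  bounded factor by factor.
\<close>

lemma sidon_squares_card_bound:
  fixes N n k :: nat and A :: "int set" and Q :: "nat set"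
  assumes A: "A \<subseteq> (\<lambda>m :: nat. (int m)\<^sup>2) ` {1..N}" and sidon: "sidon_set A"
    and Q: "\<And>p. p \<in> Q \<Longrightarrow> prime p \<and> odd p \<and> p \<le> n" and k: "card Q = k" and nk: "n ^ k \<le> N"
    and N: "N \<ge> 1"
  shows "(real (card A))\<^sup>2 \<le> (real N)\<^sup>2 * (3 * (real n + 1) / 2 ^ k)"
proof -
  define P where "P = \<Prod>Q"
  define T where "T = (real n + 1) / 2 ^ k"
  define S where "S = (\<lambda>p::nat. (\<lambda>x::nat. (int x)\<^sup>2 mod int p) ` UNIV)"
  define f where "f = (\<lambda>a::int. \<lambda>p\<in>Q. a mod int p)"
  have finQ: "finite Q" by (rule finite_subset[of _ "{..n}"]) (use Q in auto)
  have P0: "P > 0" unfolding P_def using Q prime_gt_0_nat by (intro prod_pos) auto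
  have "P \<le> n ^ k" unfolding P_def using prod_mono[of Q "\<lambda>p. p" "\<lambda>_. n"] Q k by simp
  with nk have PN: "P \<le> N" by simp
  have finA: "finite A" using A finite_subset by blast
  have "card A \<le> card ((\<lambda>m :: nat. (int m)\<^sup>2) ` {1..N})" using A by (intro card_mono) auto
  also have "\<dots> \<le> N" using card_image_le[of "{1..N}" "\<lambda>m :: nat. (int m)\<^sup>2"] by simp
  finally have cA: "card A \<le> N" .
  have "f ` A \<subseteq> PiE Q S" using A by (auto simp: f_def S_def)
  moreover have "finite (PiE Q S)"
    using finQ Q card_squares_mod_le(1) by (intro finite_PiE) (auto simp: S_def)
  ultimately have "card (f ` A) \<le> card (PiE Q S)" by (intro card_mono)
  then have cf: "real (card (f ` A)) \<le> (\<Prod>p\<in>Q. real (card (S p)))"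
    using finQ by (simp add: card_PiE flip: of_nat_prod)
  also have "\<dots> \<le> (\<Prod>p\<in>Q. (real p + 1) / 2)"
  proof (intro prod_mono conjI)
    fix p assume "p \<in> Q"
    then have "2 * card (S p) \<le> p + 1" using card_squares_mod_le(2) Q by (simp add: S_def)
    then show "real (card (S p)) \<le> (real p + 1) / 2" by (simp flip: of_nat_le_iff[where ?'a = real])
  qed simp
  also have "\<dots> = (\<Prod>p\<in>Q. real p + 1) / 2 ^ k" using k by (simp add: prod_dividef)
  also have "\<dots> \<le> (real n + 1) * (\<Prod>p\<in>Q. real p) / 2 ^ k"
  proof (intro divide_right_mono prod_Suc_le)
    show "Q \<subseteq> {1..n}" using Q prime_ge_1_nat by auto
  qed simp
  also have "\<dots> = T * real P" by (simp add: T_def P_def)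
  finally have cf: "real (card (f ` A)) \<le> T * real P" .
  have T0: "T \<ge> 0" by (simp add: T_def)
  define E where "E = {(a, b). a \<in> A \<and> b \<in> A \<and> f a = f b}"
  define E' where "E' = {(a, b). a \<in> A \<and> b \<in> A \<and> int P dvd a - b}"
  have "E \<subseteq> E'"
    unfolding E_def E'_def
  proof clarify
    fix a b assume eq: "f a = f b"
    show "int P dvd a - b"
      unfolding P_def
    proof (rule dvd_diff_prod_if_mod_eq[OF finQ])
      fix p assume p: "p \<in> Q"
      then show "prime p" using Q by blast
      show "a mod int p = b mod int p" using fun_cong[OF eq, of p] p by (simp add: f_def)
    qed
  qed
  moreover have "finite E'" by (rule finite_subset[of _ "A \<times> A"]) (use finA in \<open>auto simp: E'_def\<close>)
  ultimately have "real (card E) \<le> real (card E')" by (simp add: card_mono)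
  moreover have "A \<subseteq> {0..(int N)\<^sup>2}"
  proof
    fix a assume "a \<in> A"
    then obtain m where "m \<le> N" "a = (int m)\<^sup>2" using A by auto
    then show "a \<in> {0..(int N)\<^sup>2}" by (simp add: power_mono)
  qed
  then have "real (card E') \<le> real (card A) + 2 * real_of_int ((int N)\<^sup>2) / real P"
    unfolding E'_def by (rule sidon_card_congruent_pairs_le[OF sidon _ _ P0]) simp
  moreover have "real_of_int ((int N)\<^sup>2) = (real N)\<^sup>2" by simp
  moreover have "real (card A) \<le> real N" using cA by simp
  ultimately have cE: "real (card E) \<le> real N + 2 * (real N)\<^sup>2 / real P"
    by simp
  have "(real (card A))\<^sup>2 \<le> real (card (f ` A)) * real (card E)"
    using card_squared_le_card_image_times_card_pairs[OF finA, of f]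
    unfolding E_def of_nat_mult[symmetric] of_nat_power[symmetric] of_nat_le_iff .
  also have "\<dots> \<le> (T * real P) * (real N + 2 * (real N)\<^sup>2 / real P)"
    using cf cE T0 by (intro mult_mono) auto
  also have "\<dots> = T * (real P * real N + 2 * (real N)\<^sup>2)"
    using P0 by (simp add: field_simps)
  also have "\<dots> \<le> T * (3 * (real N)\<^sup>2)"
    using PN T0 by (intro mult_left_mono) (auto simp: power2_eq_square intro: mult_right_mono)
  finally show ?thesis by (simp add: T_def field_simps)
qed

section \<open>Optimising the modulus\<close>

text \<open>
  The parameters \<open>n\<close> and \<open>k\<close> are chosen so that \<open>n ^ k \<le> N\<close> while Chebyshev's bound, with
  \<open>n * ln 2 \<ge> 3 * L * (2 / 3) = 2 * L\<close>, supplies \<open>k\<close> odd primes up to \<open>n\<close>; hypothesis \<open>large\<close> says that one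
  of the two copies of \<open>L\<close> absorbs the lower-order terms.
\<close>

lemma sidon_squares_explicit_bound:
  fixes N :: nat and A :: "int set"
  assumes A: "A \<subseteq> (\<lambda>m :: nat. (int m)\<^sup>2) ` {1..N}" and sidon: "sidon_set A"
    and L: "L = ln (real N)" "L \<ge> 1"
    and large: "L \<le> 2 * L - ln (3 * L + 2) - ln (3 * L + 1)"
  shows "real (card A) \<le> real N * exp (ln (6 * (3 * L + 2)) / 2 - ln 2 / 2 * (L / ln (3 * L + 1)))"
proof (cases "card A = 0")
  case True
  then show ?thesis by simp
next
  case False
  then have c: "real (card A) > 0" by simp
  have N: "N > 0" using L by (cases "N = 0") auto
  define n where "n = nat \<lceil>3 * L\<rceil>"
  define k where "k = nat \<lfloor>L / ln (real n)\<rfloor>"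
  have n: "3 * L \<le> real n" "real n \<le> 3 * L + 1" using L(2) unfolding n_def by linarith+
  have n2: "n \<ge> 2" using n L(2) by linarith
  have lnn: "ln (real n) > 0" "ln (real n) \<le> ln (3 * L + 1)" using n n2 L(2) by auto
  have k: "real k \<le> L / ln (real n)" "L / ln (real n) \<le> real k + 1"
    using L(2) lnn(1) unfolding k_def by (auto simp: of_nat_nat)
  have "ln (real n ^ k) \<le> ln (real N)"
    using k(1) lnn(1) n2 L(1) by (simp add: ln_realpow pos_le_divide_eq)
  then have "real (n ^ k) \<le> real N" using n2 N by simp
  then have nk: "n ^ k \<le> N" by (simp only: of_nat_le_iff)
  have "real k \<le> (2 * L - ln (3 * L + 2)) / ln (real n) - 1"
  proof -
    have "L / ln (real n) \<le> (2 * L - ln (3 * L + 2) - ln (real n)) / ln (real n)"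
      using large lnn by (intro divide_right_mono) auto
    also have "\<dots> = (2 * L - ln (3 * L + 2)) / ln (real n) - 1"
      using lnn(1) by (simp add: diff_divide_distrib)
    finally show ?thesis using k(1) by linarith
  qed
  also have "\<dots> \<le> (real n * ln 2 - ln (real n + 1)) / ln (real n) - 1"
  proof -
    have "3 * L * (2 / 3) \<le> real n * ln 2"
      using n(1) L(2) ln2_ge_two_thirds by (intro mult_mono) auto
    moreover have "ln (real n + 1) \<le> ln (3 * L + 2)" using n L(2) by simp
    ultimately show ?thesis using lnn(1) by (intro diff_right_mono divide_right_mono) auto
  qed
  also have "\<dots> \<le> real (card {p. prime p \<and> odd p \<and> p \<le> n})"
    by (rule card_odd_primes_ge[OF n2])
  finally have "k \<le> card {p. prime p \<and> odd p \<and> p \<le> n}" by simp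
  then obtain Q where Q: "Q \<subseteq> {p. prime p \<and> odd p \<and> p \<le> n}" "card Q = k"
    by (meson obtain_subset_with_card_n)
  have "(real (card A))\<^sup>2 \<le> (real N)\<^sup>2 * (3 * (real n + 1) / 2 ^ k)"
    by (rule sidon_squares_card_bound[OF A sidon _ Q(2) nk]) (use Q(1) N in auto)
  also have "\<dots> \<le> (real N)\<^sup>2 * (3 * (3 * L + 2) / 2 ^ k)"
    using n by (intro mult_left_mono divide_right_mono) auto
  finally have "ln ((real (card A))\<^sup>2) \<le> ln ((real N)\<^sup>2 * (3 * (3 * L + 2) / 2 ^ k))"
    using c N L(2) by (subst ln_le_cancel_iff) auto
  also have "\<dots> = 2 * ln (real N) + (ln (3 * (3 * L + 2)) - real k * ln 2)"
    using N L(2) by (simp add: ln_mult ln_div ln_realpow)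
  finally have "2 * ln (real (card A)) \<le> 2 * L + ln (3 * (3 * L + 2)) - real k * ln 2"
    using c L(1) by (simp add: ln_realpow)
  moreover define u where "u = L / ln (3 * L + 1)"
  have "u - 1 \<le> real k"
    unfolding u_def using k(2) frac_le[of L L "ln (real n)" "ln (3 * L + 1)"] lnn L(2) by linarith
  then have "(u - 1) * ln 2 \<le> real k * ln 2" by (intro mult_right_mono) auto
  moreover have "ln (6 * (3 * L + 2)) = ln 2 + ln (3 * (3 * L + 2))"
    using L(2) ln_mult[of 2 "3 * (3 * L + 2)"] by simp
  ultimately have "ln (real (card A)) \<le> L + (ln (6 * (3 * L + 2)) / 2 - ln 2 / 2 * u)"
    using mult.commute[of "ln 2" u] unfolding left_diff_distrib by argo
  then have "exp (ln (real (card A))) \<le> exp (L + (ln (6 * (3 * L + 2)) / 2 - ln 2 / 2 * u))"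
    by simp
  also have "\<dots> = real N * exp (ln (6 * (3 * L + 2)) / 2 - ln 2 / 2 * u)"
    using N L(1) by (subst exp_add) simp
  finally show ?thesis using c by (simp add: u_def)
qed

theorem corollary1p2:
  "\<exists>\<epsilon> :: nat \<Rightarrow> real. \<epsilon> \<longlonglongrightarrow> 0 \<and>
     (\<forall>N :: nat. \<forall>A :: int set.
        2 \<le> N \<longrightarrow> A \<subseteq> (\<lambda>n :: nat. (int n)\<^sup>2) ` {1..N} \<longrightarrow> sidon_set A \<longrightarrow>
          real (card A) \<le>
            real N * exp (- (ln 2 / 2 - \<epsilon> N) * (ln (real N) / ln (ln (real N)))))"
proof -
  \<comment> \<open>The value of \<open>\<epsilon>\<close> that turns the explicit bound into the required shape.\<close>
  define g where "g = (\<lambda>N::nat. ln 2 / 2 - ln 2 / 2 * (ln (ln (real N)) / ln (3 * ln (real N) + 1))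
     + ln (ln (real N)) / (2 * ln (real N)) * ln (6 * (3 * ln (real N) + 2)))"
  have g: "g \<longlonglongrightarrow> 0" unfolding g_def by real_asymp
  define good where "good = (\<lambda>N::nat. ln (real N) > 1 \<and>
     ln (real N) \<le> 2 * ln (real N) - ln (3 * ln (real N) + 2) - ln (3 * ln (real N) + 1))"
  have good: "eventually good sequentially"
    unfolding good_def by (intro eventually_conj; real_asymp)
  \<comment> \<open>For the finitely many other \<open>N\<close> the exponent is made 0, leaving the trivial bound \<open>card A \<le> N\<close>.\<close>
  define \<epsilon> where "\<epsilon> = (\<lambda>N. if good N then g N else ln 2 / 2)"
  have "eventually (\<lambda>N. g N = \<epsilon> N) sequentially"
    using good by eventually_elim (simp add: \<epsilon>_def)
  with g have "\<epsilon> \<longlonglongrightarrow> 0" by (rule Lim_transform_eventually)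
  moreover have "real (card A) \<le> real N * exp (- (ln 2 / 2 - \<epsilon> N) * (ln (real N) / ln (ln (real N))))"
    if A: "A \<subseteq> (\<lambda>n :: nat. (int n)\<^sup>2) ` {1..N}" and sidon: "sidon_set A" for N A
  proof (cases "good N")
    case True
    define L where "L = ln (real N)"
    from True have L: "L > 1" "L \<le> 2 * L - ln (3 * L + 2) - ln (3 * L + 1)"
      by (auto simp: good_def L_def)
    have "ln L \<noteq> 0" using L by simp
    then have "- (ln 2 / 2 - \<epsilon> N) * (L / ln L)
        = ln (6 * (3 * L + 2)) / 2 - ln 2 / 2 * (L / ln (3 * L + 1))"
      using True L(1) by (simp add: \<epsilon>_def g_def field_simps flip: L_def)
    then show ?thesis
      using sidon_squares_explicit_bound[OF A sidon L_def] L by (simp add: L_def)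
  next
    case False
    have "card A \<le> card ((\<lambda>n :: nat. (int n)\<^sup>2) ` {1..N})" using A by (intro card_mono) auto
    also have "\<dots> \<le> N" using card_image_le[of "{1..N}" "\<lambda>n :: nat. (int n)\<^sup>2"] by simp
    finally show ?thesis using False by (simp add: \<epsilon>_def)
  qed
  ultimately show ?thesis by blast
qed

end
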